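(* Every graph with no $K_{2,3}$ minor is a quasi-hamiltonian pseudo-outerplanar graph. Moreover, some quasi-hamiltonian pseudo-outerplanar graph has a $K_{2,3}$ minor. In symbols, $\mathcal{M}_{2,3}\subsetneq\mathcal{P}_H$.
   Context: All graphs are finite, simple and undirected. A block is a maximal 2-connected subgraph; bridges are blocks too. A graph is pseudo-outerplanar if each of its blocks can be drawn in the plane so that its vertices lie on a fixed circle, its edges lie inside the disk bounded by that circle, and each edge crosses at most one other edge. A graph is quasi-hamiltonian if each of its blocks is hamiltonian; blocks that are single edges or single vertices count as hamiltonian. $\mathcal{M}_{2,3}$ is the class of $K_{2,3}$-minor-free graphs. $\mathcal{P}_H$ is the class of quasi-hamiltonian pseudo-outerplanar graphs. *)

theory Defs
  imports "HOL-Analysis.Analysis" "Graph_Theory.Graph_Theory"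
begin

text \<open>
  A finite simple undirected graph is a \<^locale>\<open>pair_graph\<close>: finite vertex set, irreflexive symmetric
  set of arcs, the undirected edge \<open>{u, v}\<close> being represented by both \<open>(u, v)\<close> and \<open>(v, u)\<close>.
  The null graph is allowed; it has no blocks and no \<open>K\<^bsub>2,3\<^esub>\<close> minor.
\<close>

definition uedges :: "'a pair_pre_digraph \<Rightarrow> 'a set set" where
  "uedges G = {{u, v} | u v. (u, v) \<in> parcs G}"


section \<open>Minors\<close>

text \<open>
  \<open>H\<close> is a minor of \<open>G\<close> if it arises from a subgraph of \<open>G\<close> by contracting the pairwise disjoint
  connected branch sets \<open>\<beta> x\<close>, one for each vertex \<open>x\<close> of \<open>H\<close>. Branch sets are nonempty because
  \<^const>\<open>Digraph_Component.connected\<close> excludes the null graph.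
\<close>

definition is_minor :: "'b pair_pre_digraph \<Rightarrow> 'a pair_pre_digraph \<Rightarrow> bool" where
  "is_minor H G \<longleftrightarrow> (\<exists>\<beta>.
     (\<forall>x\<in>pverts H. \<beta> x \<subseteq> pverts G \<and> Digraph_Component.connected (with_proj G \<restriction> \<beta> x)) \<and>
     (\<forall>x\<in>pverts H. \<forall>y\<in>pverts H. x \<noteq> y \<longrightarrow> \<beta> x \<inter> \<beta> y = {}) \<and>
     (\<forall>(x, y)\<in>parcs H. \<exists>u\<in>\<beta> x. \<exists>v\<in>\<beta> y. (u, v) \<in> parcs G))"

text \<open>The vertex type of the copy of \<open>K\<^bsub>2,3\<^esub>\<close> is immaterial; natural numbers provide enough vertices.\<close>

definition has_K23_minor :: "'a pair_pre_digraph \<Rightarrow> bool" where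
  "has_K23_minor G \<longleftrightarrow>
     (\<exists>K :: nat pair_pre_digraph. K\<^bsub>2,3\<^esub> (with_proj K) \<and> is_minor K G)"


section \<open>Blocks\<close>

definition two_connected :: "'a pair_pre_digraph \<Rightarrow> bool" where
  "two_connected G \<longleftrightarrow>
     3 \<le> card (pverts G) \<and> Digraph_Component.connected (with_proj G) \<and>
     (\<forall>v\<in>pverts G. Digraph_Component.connected (pre_digraph.del_vert (with_proj G) v))"

definition two_connected_subgraph :: "'a pair_pre_digraph \<Rightarrow> 'a pair_pre_digraph \<Rightarrow> bool" where
  "two_connected_subgraph B G \<longleftrightarrow>
     pair_graph B \<and> subgraph (with_proj B) (with_proj G) \<and> two_connected B"

definition bridge :: "'a pair_pre_digraph \<Rightarrow> 'a \<Rightarrow> 'a \<Rightarrow> bool" where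
  "bridge G u v \<longleftrightarrow> (u, v) \<in> parcs G \<and>
     \<not> reachable (with_proj (G\<lparr>parcs := parcs G - {(u, v), (v, u)}\<rparr>)) u v"

text \<open>
  Since \<^const>\<open>two_connected\<close> demands three vertices, the blocks on fewer vertices, namely bridges with
  their ends and isolated vertices, are listed separately.
\<close>

definition is_block :: "'a pair_pre_digraph \<Rightarrow> 'a pair_pre_digraph \<Rightarrow> bool" where
  "is_block B G \<longleftrightarrow>
     two_connected_subgraph B G \<and>
       (\<forall>C. two_connected_subgraph C G \<and> subgraph (with_proj B) (with_proj C) \<longrightarrow> C = B) \<or>
     (\<exists>u v. bridge G u v \<and> B = \<lparr>pverts = {u, v}, parcs = {(u, v), (v, u)}\<rparr>) \<or>
     (\<exists>v\<in>pverts G. (\<forall>u. (v, u) \<notin> parcs G) \<and> B = \<lparr>pverts = {v}, parcs = {}\<rparr>)"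


section \<open>Quasi-hamiltonian graphs\<close>

text \<open>
  The lower bound on the length is needed because \<open>[(u, v), (v, u)]\<close> is a cycle in the directed sense.
\<close>

definition hamiltonian :: "'a pair_pre_digraph \<Rightarrow> bool" where
  "hamiltonian G \<longleftrightarrow>
     (\<exists>p. pre_digraph.cycle (with_proj G) p \<and> 3 \<le> length p \<and> fst ` set p = pverts G)"

definition quasi_hamiltonian :: "'a pair_pre_digraph \<Rightarrow> bool" where
  "quasi_hamiltonian G \<longleftrightarrow>
     (\<forall>B. is_block B G \<longrightarrow> hamiltonian B \<or> K\<^bsub>1\<^esub> (with_proj B) \<or> K\<^bsub>2\<^esub> (with_proj B))"


section \<open>Pseudo-outerplanar graphs\<close>

text \<open>
  Topological drawings in the closed unit disk of the plane \<^typ>\<open>complex\<close>: vertices are distinct points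
  of the unit circle, and the edge \<open>e\<close> is a simple arc \<open>\<gamma> e\<close> in the disk that joins its two ends and
  meets no other vertex. As usual for drawings, two edges share only finitely many points, so
  overlapping along a curve is excluded. Every common point of two edges that is not a vertex
  counts as a crossing.
\<close>

definition disk_drawing ::
    "'a pair_pre_digraph \<Rightarrow> ('a \<Rightarrow> complex) \<Rightarrow> ('a set \<Rightarrow> real \<Rightarrow> complex) \<Rightarrow> bool" where
  "disk_drawing G pos \<gamma> \<longleftrightarrow>
     inj_on pos (pverts G) \<and> pos ` pverts G \<subseteq> sphere 0 1 \<and>
     (\<forall>e\<in>uedges G. arc (\<gamma> e) \<and> {pathstart (\<gamma> e), pathfinish (\<gamma> e)} = pos ` e \<and>
        path_image (\<gamma> e) \<subseteq> cball 0 1 \<and> path_image (\<gamma> e) \<inter> pos ` pverts G = pos ` e) \<and>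
     (\<forall>e\<in>uedges G. \<forall>f\<in>uedges G. e \<noteq> f \<longrightarrow> finite (path_image (\<gamma> e) \<inter> path_image (\<gamma> f)))"

definition crosses ::
    "'a pair_pre_digraph \<Rightarrow> ('a \<Rightarrow> complex) \<Rightarrow> ('a set \<Rightarrow> real \<Rightarrow> complex) \<Rightarrow> 'a set \<Rightarrow> 'a set \<Rightarrow> bool" where
  "crosses G pos \<gamma> e f \<longleftrightarrow>
     e \<noteq> f \<and> (path_image (\<gamma> e) \<inter> path_image (\<gamma> f)) - pos ` pverts G \<noteq> {}"

definition pseudo_outerplanar :: "'a pair_pre_digraph \<Rightarrow> bool" where
  "pseudo_outerplanar G \<longleftrightarrow>
     (\<forall>B. is_block B G \<longrightarrow> (\<exists>pos \<gamma>. disk_drawing B pos \<gamma> \<and>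
        (\<forall>e\<in>uedges B. \<forall>f\<in>uedges B. \<forall>g\<in>uedges B.
           crosses B pos \<gamma> e f \<and> crosses B pos \<gamma> e g \<longrightarrow> f = g)))"


section \<open>The two classes\<close>

definition M23 :: "'a pair_pre_digraph set" where
  "M23 = {G. pair_graph G \<and> \<not> has_K23_minor G}"

definition PH :: "'a pair_pre_digraph set" where
  "PH = {G. pair_graph G \<and> quasi_hamiltonian G \<and> pseudo_outerplanar G}"

end

theory Submission
  imports Defs
begin

text \<open>
  Let \<open>B\<close> be a 2-connected graph without \<open>K\<^bsub>2,3\<^esub>\<close> minor. If a longest cycle \<open>C\<close> missed a vertex, then
  some path outside \<open>C\<close> would join two vertices \<open>a\<close>, \<open>b\<close> of \<open>C\<close>. By maximality these are not adjacent on
  \<open>C\<close>, so the path and the two arcs of \<open>C\<close> between \<open>a\<close> and \<open>b\<close> are the three branch sets that complete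
  \<open>{a}\<close>, \<open>{b}\<close> to a \<open>K\<^bsub>2,3\<^esub>\<close>. Hence \<open>B\<close> has a Hamiltonian cycle. Place its vertices on the circle in this
  order and draw edges as straight chords. If two chords cross, then their four ends are consecutive
  on the cycle, as otherwise there is again a \<open>K\<^bsub>2,3\<^esub>\<close> minor; so \<open>B\<close> has only four vertices, and its
  two diagonals are the only crossing pair.
\<close>

section \<open>Connected vertex sets, paths and cycles as vertex lists\<close>

text \<open>Stated for a bare relation, so that branch sets, whole graphs and graphs with a deleted
  vertex fall under one notion. Nonemptiness mirrors the exclusion of the null graph by
  \<open>connected\<close>.\<close>

definition conn_on :: "'a rel \<Rightarrow> 'a set \<Rightarrow> bool" where
  "conn_on E S \<longleftrightarrow> S \<noteq> {} \<and> (\<forall>u\<in>S. \<forall>v\<in>S. (u, v) \<in> (Restr E S)\<^sup>*)"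

definition path_in :: "'a rel \<Rightarrow> 'a list \<Rightarrow> bool" where
  "path_in E xs \<longleftrightarrow> successively (\<lambda>x y. (x, y) \<in> E) xs"

text \<open>The first vertex is not repeated at the end, so shifting the start is a rotation of the
  list; length 3 rules out going back and forth along one edge.\<close>

definition cycle_in :: "'a rel \<Rightarrow> 'a list \<Rightarrow> bool" where
  "cycle_in E xs \<longleftrightarrow> path_in E xs \<and> (last xs, hd xs) \<in> E \<and> distinct xs \<and> 3 \<le> length xs"

lemma path_in_simps [simp]:
  "path_in E []" "path_in E [x]"
  "path_in E (x # y # zs) \<longleftrightarrow> (x, y) \<in> E \<and> path_in E (y # zs)"
  by (auto simp: path_in_def)

lemma path_in_Cons:
  "path_in E (x # xs) \<longleftrightarrow> (xs \<noteq> [] \<longrightarrow> (x, hd xs) \<in> E) \<and> path_in E xs"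
  by (auto simp: path_in_def successively_Cons)

lemma path_in_append:
  "path_in E (xs @ ys) \<longleftrightarrow>
     path_in E xs \<and> path_in E ys \<and> (xs \<noteq> [] \<and> ys \<noteq> [] \<longrightarrow> (last xs, hd ys) \<in> E)"
  by (auto simp: path_in_def successively_append_iff)

lemma path_in_rev:
  assumes "sym E" "path_in E xs"
  shows "path_in E (rev xs)"
proof -
  have "(\<lambda>x y. (y, x) \<in> E) = (\<lambda>x y. (x, y) \<in> E)"
    using assms(1) by (auto simp: fun_eq_iff dest: symD)
  with assms(2) show ?thesis unfolding path_in_def successively_rev by metis
qed

lemma cycle_in_rotate:
  assumes "cycle_in E (xs @ ys)"
  shows "cycle_in E (ys @ xs)"
  using assms
  by (cases "xs = []"; cases "ys = []") (auto simp: cycle_in_def path_in_append)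

lemma conn_onD:
  assumes "conn_on E S" "u \<in> S" "v \<in> S"
  shows "(u, v) \<in> (Restr E S)\<^sup>*"
  using assms by (simp add: conn_on_def)

lemma conn_on_mono:
  assumes "conn_on E S" "E \<subseteq> F"
  shows "conn_on F S"
proof -
  have "(Restr E S)\<^sup>* \<subseteq> (Restr F S)\<^sup>*" using assms(2) by (intro rtrancl_mono) auto
  then show ?thesis using assms(1) by (auto simp: conn_on_def)
qed

lemma conn_on_centerI:
  assumes "sym E" "c \<in> S" "\<And>v. v \<in> S \<Longrightarrow> v \<noteq> c \<Longrightarrow> (c, v) \<in> E"
  shows "conn_on E S"
proof -
  have "(c, v) \<in> (Restr E S)\<^sup>*" "(v, c) \<in> (Restr E S)\<^sup>*" if "v \<in> S" for v
    using that assms by (cases "v = c"; auto dest: symD)+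
  then show ?thesis using assms(2) by (auto simp: conn_on_def intro: rtrancl_trans)
qed

lemma conn_on_path:
  assumes "sym E" "path_in E xs" "xs \<noteq> []"
  shows "conn_on E (set xs)"
  using assms(2,3)
proof (induction xs rule: induct_list012)
  case 1
  then show ?case by simp
next
  case (2 x)
  then show ?case by (auto simp: conn_on_def)
next
  case (3 x y zs)
  define xs where "xs = y # zs"
  from 3 have IH: "conn_on E (set xs)" and e: "(x, hd xs) \<in> E" by (auto simp: xs_def)
  let ?R = "Restr E (set (x # xs))"
  have mono: "(Restr E (set xs))\<^sup>* \<subseteq> ?R\<^sup>*" by (intro rtrancl_mono) auto
  have h: "hd xs \<in> set xs" by (simp add: xs_def)
  have 1: "(u, hd xs) \<in> ?R\<^sup>*" "(hd xs, u) \<in> ?R\<^sup>*" if u: "u \<in> set (x # xs)" for u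
  proof -
    have "(u, hd xs) \<in> ?R\<^sup>* \<and> (hd xs, u) \<in> ?R\<^sup>*"
    proof (cases "u = x")
      case True
      have "(x, hd xs) \<in> ?R" "(hd xs, x) \<in> ?R" using e h assms(1) by (auto dest: symD)
      then show ?thesis using True by blast
    next
      case False
      then show ?thesis using u h IH mono by (auto dest: conn_onD)
    qed
    then show "(u, hd xs) \<in> ?R\<^sup>*" "(hd xs, u) \<in> ?R\<^sup>*" by auto
  qed
  then show ?case unfolding conn_on_def xs_def[symmetric]
    using rtrancl_trans[OF 1(1) 1(2)] by simp
qed

text \<open>A walk is extended arc by arc; when it returns to a vertex already listed, the list is
  cut there, which keeps it distinct.\<close>

lemma path_in_exists:
  assumes "(u, v) \<in> (Restr E S)\<^sup>*" "u \<in> S"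
  shows "\<exists>p. p \<noteq> [] \<and> hd p = u \<and> last p = v \<and> distinct p \<and> path_in E p \<and> set p \<subseteq> S"
  using assms
proof (induction rule: rtrancl_induct)
  case base
  then show ?case by (intro exI[of _ "[u]"]) auto
next
  case (step y z)
  then obtain p where p: "p \<noteq> []" "hd p = u" "last p = y" "distinct p" "path_in E p" "set p \<subseteq> S"
    by auto
  show ?case
  proof (cases "z \<in> set p")
    case True
    then obtain p1 p2 where "p = p1 @ z # p2" by (meson split_list)
    then show ?thesis using p
      by (intro exI[of _ "p1 @ [z]"]) (auto simp: path_in_append hd_append)
  next
    case False
    then show ?thesis using p step
      by (intro exI[of _ "p @ [z]"]) (auto simp: path_in_append)
  qed
qed

lemma conn_on_leaves:
  assumes "conn_on E S" "u \<in> S \<inter> A" "v \<in> S - A"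
  obtains x y where "(x, y) \<in> E" "x \<in> S \<inter> A" "y \<in> S - A"
proof -
  have "(u, v) \<in> (Restr E S)\<^sup>*" using assms by (auto dest: conn_onD)
  then have "v \<in> A \<or> (\<exists>x y. (x, y) \<in> E \<and> x \<in> S \<inter> A \<and> y \<in> S - A)"
    by (induction rule: rtrancl_induct) (use assms in auto)
  then show ?thesis using assms that by blast
qed

lemma cycle_in_split:
  assumes "cycle_in E xs" "a \<in> set xs" "b \<in> set xs" "a \<noteq> b"
  obtains ys zs where "cycle_in E (a # ys @ b # zs)" "set (a # ys @ b # zs) = set xs"
    "length (a # ys @ b # zs) = length xs"
proof -
  obtain p q where pq: "xs = p @ a # q" using assms(2) by (meson split_list)
  then have "b \<in> set (q @ p)" using assms by auto
  then obtain ys zs where yz: "q @ p = ys @ b # zs" by (meson split_list)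
  have c: "cycle_in E ((a # q) @ p)" using cycle_in_rotate[of E p "a # q"] assms pq by simp
  have s: "set q \<union> set p = insert b (set ys \<union> set zs)"
    "length q + length p = Suc (length ys + length zs)"
    using arg_cong[OF yz, of set] arg_cong[OF yz, of length] by simp_all
  show ?thesis
    by (rule that[of ys zs]) (use c yz s pq in \<open>simp_all add: Un_commute insert_commute\<close>)
qed


section \<open>Minors\<close>

lemma pair_graph_finite: "pair_graph G \<Longrightarrow> finite (pverts G)"
  by (simp add: pair_graph_def pair_digraph_def pair_fin_digraph.pair_finite_verts)

lemma pair_graph_sym:
  assumes "pair_graph G"
  shows "sym (parcs G)"
proof -
  interpret pair_graph G by fact
  show ?thesis using pair_sym_arcs by (simp add: symmetric_def)
qed

lemma pair_graph_subset:
  assumes "pair_graph G"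
  shows "parcs G \<subseteq> pverts G \<times> pverts G"
proof -
  interpret pair_graph G by fact
  show ?thesis by (auto dest: in_arcsD1 in_arcsD2)
qed

lemma pair_graph_irrefl:
  assumes "pair_graph G" "(u, v) \<in> parcs G"
  shows "u \<noteq> v"
proof -
  interpret pair_graph G by fact
  show ?thesis using assms no_loops' by blast
qed

lemma rtrancl_on_Restr:
  "u \<in> S \<Longrightarrow> (u, v) \<in> rtrancl_on S (Restr E S) \<longleftrightarrow> (u, v) \<in> (Restr E S)\<^sup>*"
proof
  assume u: "u \<in> S" and "(u, v) \<in> (Restr E S)\<^sup>*"
  from this(2) show "(u, v) \<in> rtrancl_on S (Restr E S)"
    by (induction rule: rtrancl_induct) (use u in \<open>auto intro: rtrancl_on_into_rtrancl_on\<close>)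
qed (rule rtrancl_on_rtranclI)

text \<open>\<open>connected\<close> refers to the symmetric closure of the arcs, which changes
  nothing for a symmetric relation. Keeping \<open>H\<close> abstract serves induced subgraphs, the
  whole graph and vertex deletion alike.\<close>

lemma connected_iff_conn_on:
  assumes "sym E" "verts H = S" "arcs H = Restr E S" "tail H = fst" "head H = snd"
  shows "Digraph_Component.connected H \<longleftrightarrow> conn_on E S"
proof -
  have "parcs (mk_symmetric H) = Restr E S"
    by (auto simp: mk_symmetric_def assms intro: symD[OF assms(1)])
  then show ?thesis
    by (auto simp: Digraph_Component.connected_def strongly_connected_def reachable_def conn_on_def
        assms(2) rtrancl_on_Restr)
qed

lemma connected_restrict_iff:
  assumes "pair_graph G"
  shows "Digraph_Component.connected (with_proj G \<restriction> S) \<longleftrightarrow> conn_on (parcs G) S"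
  using pair_graph_sym[OF assms] by (intro connected_iff_conn_on) (auto simp: induce_subgraph_def)

lemma two_connected_iff:
  assumes "pair_graph G"
  shows "two_connected G \<longleftrightarrow> 3 \<le> card (pverts G) \<and> conn_on (parcs G) (pverts G) \<and>
    (\<forall>v\<in>pverts G. conn_on (parcs G) (pverts G - {v}))"
proof -
  have "Digraph_Component.connected (with_proj G) \<longleftrightarrow> conn_on (parcs G) (pverts G)"
    using pair_graph_sym[OF assms] pair_graph_subset[OF assms]
    by (intro connected_iff_conn_on) auto
  moreover have "Digraph_Component.connected (pre_digraph.del_vert (with_proj G) v) \<longleftrightarrow>
      conn_on (parcs G) (pverts G - {v})" for v
    using pair_graph_sym[OF assms] pair_graph_subset[OF assms]
    by (intro connected_iff_conn_on) (auto simp: pre_digraph.del_vert_def)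
  ultimately show ?thesis by (simp add: two_connected_def)
qed

lemma has_K23_minorI:
  assumes G: "pair_graph G"
    and ab: "a \<in> pverts G" "b \<in> pverts G" "a \<noteq> b"
    and S: "\<And>i::nat. i < 3 \<Longrightarrow> S i \<subseteq> pverts G - {a, b}" "\<And>i. i < 3 \<Longrightarrow> conn_on (parcs G) (S i)"
    and disj: "S 0 \<inter> S 1 = {}" "S 0 \<inter> S 2 = {}" "S 1 \<inter> S 2 = {}"
    and adj: "\<And>i. i < 3 \<Longrightarrow> \<exists>v\<in>S i. (a, v) \<in> parcs G" "\<And>i. i < 3 \<Longrightarrow> \<exists>v\<in>S i. (v, b) \<in> parcs G"
  shows "has_K23_minor G"
proof -
  \<comment> \<open>The three-element side is \<open>{0,1,2}\<close>, so that \<open>S\<close>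
    indexes its branch sets directly; 3 and 4 stand for \<open>a\<close> and
    \<open>b\<close>.\<close>
  define K :: "nat pair_pre_digraph" where
    "K = \<lparr>pverts = {0,1,2} \<union> {3,4}, parcs = {3,4} \<times> {0,1,2} \<union> {0,1,2} \<times> {3,4}\<rparr>"
  have K: "K\<^bsub>2,3\<^esub> (with_proj K)"
    unfolding complete_bipartite_digraph_pair_def
    by (intro conjI exI[of _ "{3,4}"] exI[of _ "{0,1,2}"]) (auto simp: K_def)
  define \<beta> where "\<beta> i = (if i = 3 then {a} else if i = 4 then {b} else S i)" for i :: nat
  have "conn_on (parcs G) {x}" for x by (auto simp: conn_on_def)
  then have 1: "\<forall>x\<in>pverts K. \<beta> x \<subseteq> pverts G \<and> conn_on (parcs G) (\<beta> x)"
    using S[of 0] S[of 1] S[of 2] ab by (simp add: K_def \<beta>_def) blast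
  have 2: "\<forall>x\<in>pverts K. \<forall>y\<in>pverts K. x \<noteq> y \<longrightarrow> \<beta> x \<inter> \<beta> y = {}"
    using disj ab(3) S(1)[of 0] S(1)[of 1] S(1)[of 2] unfolding K_def \<beta>_def
    by (simp add: Int_commute) blast
  have 3: "\<forall>(x, y)\<in>parcs K. \<exists>u\<in>\<beta> x. \<exists>v\<in>\<beta> y. (u, v) \<in> parcs G"
    using adj[of 0] adj[of 1] adj[of 2] pair_graph_sym[OF G]
    by (auto simp: K_def \<beta>_def dest: symD)
  show ?thesis
    unfolding has_K23_minor_def is_minor_def connected_restrict_iff[OF G] using K 1 2 3 by blast
qed

lemma has_K23_minor_mono:
  assumes "pair_graph B" "pair_graph G" "pverts B \<subseteq> pverts G" "parcs B \<subseteq> parcs G"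
    and "has_K23_minor B"
  shows "has_K23_minor G"
proof -
  from assms(5) obtain K :: "nat pair_pre_digraph" and \<beta> where K: "K\<^bsub>2,3\<^esub> (with_proj K)"
    and 1: "\<forall>x\<in>pverts K. \<beta> x \<subseteq> pverts B \<and> conn_on (parcs B) (\<beta> x)"
    and 2: "\<forall>x\<in>pverts K. \<forall>y\<in>pverts K. x \<noteq> y \<longrightarrow> \<beta> x \<inter> \<beta> y = {}"
    and 3: "\<forall>(x, y)\<in>parcs K. \<exists>u\<in>\<beta> x. \<exists>v\<in>\<beta> y. (u, v) \<in> parcs B"
    unfolding has_K23_minor_def is_minor_def connected_restrict_iff[OF assms(1)] by blast
  have 1: "\<forall>x\<in>pverts K. \<beta> x \<subseteq> pverts G \<and> conn_on (parcs G) (\<beta> x)"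
    using 1 assms(3,4) by (meson conn_on_mono subset_trans)
  have 3: "\<forall>(x, y)\<in>parcs K. \<exists>u\<in>\<beta> x. \<exists>v\<in>\<beta> y. (u, v) \<in> parcs G"
    using 3 assms(4) by fast
  show ?thesis
    unfolding has_K23_minor_def is_minor_def connected_restrict_iff[OF assms(2)]
    using K 1 2 3 by blast
qed


section \<open>Cycles in graphs without \<open>K\<^bsub>2,3\<^esub>\<close> minor\<close>

text \<open>The branch sets are \<open>{a}\<close>, \<open>{b}\<close> and the three paths. The
  neighbours of \<open>a\<close> and \<open>b\<close> may sit anywhere on a path, not only at its
  ends; the chord argument relies on this.\<close>

lemma theta_K23_minor:
  assumes G: "pair_graph G"
    and ps: "path_in (parcs G) ps" "path_in (parcs G) qs" "path_in (parcs G) rs"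
    and ne: "ps \<noteq> []" "qs \<noteq> []" "rs \<noteq> []"
    and dist: "distinct (a # b # ps @ qs @ rs)"
    and adj: "\<And>xs. xs \<in> {ps, qs, rs} \<Longrightarrow> (\<exists>v\<in>set xs. (a, v) \<in> parcs G) \<and> (\<exists>v\<in>set xs. (v, b) \<in> parcs G)"
  shows "has_K23_minor G"
proof -
  define S where "S i = (if i = 0 then set ps else if i = 1 then set qs else set rs)" for i :: nat
  \<comment> \<open>A one-vertex path satisfies \<open>path_in\<close> wherever it lies, so
    membership in the graph comes from the neighbour of \<open>a\<close> and spreads along
    arcs.\<close>
  have sub: "set xs \<subseteq> pverts G" if xs: "path_in (parcs G) xs" "\<exists>v\<in>set xs. (a, v) \<in> parcs G" for xs
  proof
    fix x assume x: "x \<in> set xs"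
    obtain v where v: "v \<in> set xs" "(a, v) \<in> parcs G" using xs by blast
    have "conn_on (parcs G) (set xs)"
      using conn_on_path[OF pair_graph_sym[OF G] xs(1)] v by force
    then have "(v, x) \<in> (Restr (parcs G) (set xs))\<^sup>*" using x v by (auto dest: conn_onD)
    then show "x \<in> pverts G"
      using v pair_graph_subset[OF G] by (induction rule: rtrancl_induct) auto
  qed
  have "a \<in> pverts G" "b \<in> pverts G"
    using adj[of ps] pair_graph_subset[OF G] by auto
  then show ?thesis
    by (rule has_K23_minorI[OF G, where S = S])
      (use dist adj[of ps] adj[of qs] adj[of rs] sub[of ps] sub[of qs] sub[of rs] ps ne
        conn_on_path[OF pair_graph_sym[OF G]] in \<open>auto simp: S_def\<close>)
qed

text \<open>If \<open>a\<close> and \<open>b\<close> are consecutive on the cycle, the ear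
  \<open>ds\<close> replaces the edge between them; otherwise both arcs are nonempty and form a
  theta with the ear.\<close>

lemma ear_K23_minor_or_longer_cycle:
  assumes G: "pair_graph G"
    and c: "cycle_in (parcs G) (a # ys @ b # zs)"
    and d: "path_in (parcs G) ds" "ds \<noteq> []" "distinct ds" "set ds \<inter> set (a # ys @ b # zs) = {}"
      "(a, hd ds) \<in> parcs G" "(last ds, b) \<in> parcs G"
  shows "has_K23_minor G \<or>
    (\<exists>xs. cycle_in (parcs G) xs \<and> length xs > length (a # ys @ b # zs))"
proof -
  note sym = pair_graph_sym[OF G]
  consider "ys = []" | "zs = []" | "ys \<noteq> []" "zs \<noteq> []" by blast
  then show ?thesis
  proof cases
    case 1
    then have "cycle_in (parcs G) (a # ds @ b # zs)"
      using c d by (auto simp: cycle_in_def path_in_append path_in_Cons hd_append)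
    moreover have "length (a # ds @ b # zs) > length (a # ys @ b # zs)" using d 1 by simp
    ultimately show ?thesis by blast
  next
    case 2
    \<comment> \<open>Here the edge between \<open>a\<close> and \<open>b\<close> is the closing
      one, so the ear is traversed from \<open>b\<close> back to \<open>a\<close>.\<close>
    then have "cycle_in (parcs G) (a # ys @ b # rev ds)"
      using c d path_in_rev[OF sym d(1)] symD[OF sym d(5)] symD[OF sym d(6)]
      by (auto simp: cycle_in_def path_in_append path_in_Cons hd_append hd_rev last_rev)
    moreover have "length (a # ys @ b # rev ds) > length (a # ys @ b # zs)" using d 2 by simp
    ultimately show ?thesis by blast
  next
    case 3
    have "(a, hd ys) \<in> parcs G" "(last ys, b) \<in> parcs G" "(b, hd zs) \<in> parcs G" "(last zs, a) \<in> parcs G"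
      using c 3 by (auto simp: cycle_in_def path_in_append path_in_Cons hd_append)
    note e = this(1,2) this(3,4)[THEN symD[OF sym]]
    have "has_K23_minor G"
      by (rule theta_K23_minor[OF G, of ys zs ds a b])
        (use c d e 3 in \<open>auto simp: cycle_in_def path_in_append path_in_Cons intro: hd_in_set last_in_set\<close>)
    then show ?thesis ..
  qed
qed

text \<open>A vertex \<open>a\<close> has two neighbours: \<open>b\<close> by connectivity and
  \<open>c\<close> by connectivity after deleting \<open>b\<close>. A path from \<open>b\<close> to
  \<open>c\<close> avoiding \<open>a\<close> then closes up through \<open>a\<close>.\<close>

lemma two_connected_has_cycle:
  assumes G: "pair_graph G" and tc: "two_connected G"
  shows "\<exists>xs. cycle_in (parcs G) xs"
proof -
  let ?V = "pverts G" and ?E = "parcs G"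
  have V: "3 \<le> card ?V" and con: "conn_on ?E ?V" and con': "\<And>v. v \<in> ?V \<Longrightarrow> conn_on ?E (?V - {v})"
    using tc by (auto simp: two_connected_iff[OF G])
  have other: "\<exists>w\<in>?V. w \<notin> {x, y}" for x y
  proof (rule ccontr)
    assume "\<not> ?thesis"
    then have "card ?V \<le> card {x, y}" by (intro card_mono) auto
    also have "\<dots> \<le> 2" by (simp add: card_insert_if)
    finally show False using V by simp
  qed
  obtain a where a: "a \<in> ?V" using V by fastforce
  obtain w where "w \<in> ?V" "w \<noteq> a" using other[of a a] by auto
  then obtain b where b: "(a, b) \<in> ?E" "b \<in> ?V" "b \<noteq> a"
    using a by (auto intro: conn_on_leaves[OF con, of a "{a}" w])
  obtain w where "w \<in> ?V" "w \<noteq> a" "w \<noteq> b" using other[of a b] by auto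
  then obtain c where c: "(a, c) \<in> ?E" "c \<in> ?V" "c \<noteq> a" "c \<noteq> b"
    using a b by (auto intro: conn_on_leaves[OF con'[OF b(2)], of a "{a}" w])
  have "(b, c) \<in> (Restr ?E (?V - {a}))\<^sup>*" using con'[OF a] b c by (auto dest: conn_onD)
  from path_in_exists[OF this] b obtain p where p: "p \<noteq> []" "hd p = b" "last p = c" "distinct p"
      "path_in ?E p" "set p \<subseteq> ?V - {a}" by auto
  have "2 \<le> length p" using p(1-3) c(4) by (cases p rule: remdups_adj.cases) auto
  then have "cycle_in ?E (a # p)"
    using p b c symD[OF pair_graph_sym[OF G]] by (auto simp: cycle_in_def path_in_Cons)
  then show ?thesis ..
qed

lemma two_connected_hamiltonian_cycle:
  assumes G: "pair_graph G" and tc: "two_connected G" and K: "\<not> has_K23_minor G"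
  obtains xs where "cycle_in (parcs G) xs" "set xs = pverts G"
proof -
  let ?V = "pverts G" and ?E = "parcs G"
  have con: "conn_on ?E ?V" and con': "\<And>v. v \<in> ?V \<Longrightarrow> conn_on ?E (?V - {v})"
    using tc by (auto simp: two_connected_iff[OF G])
  have fin: "finite ?V" by (rule pair_graph_finite[OF G])
  \<comment> \<open>Any vertex of the cycle can be rotated to the front, where an arc ends in
    it.\<close>
  have sub: "set xs \<subseteq> ?V" if "cycle_in ?E xs" for xs
  proof
    fix x assume "x \<in> set xs"
    then obtain ys zs where "xs = ys @ x # zs" by (meson split_list)
    then have "cycle_in ?E (x # zs @ ys)" using cycle_in_rotate[of ?E ys "x # zs"] that by simp
    then show "x \<in> ?V" using pair_graph_subset[OF G] by (auto simp: cycle_in_def)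
  qed
  have bd: "length xs < Suc (card ?V)" if "cycle_in ?E xs" for xs
    using card_mono[OF fin sub[OF that]] distinct_card[of xs] that by (auto simp: cycle_in_def)
  obtain xs where xs: "cycle_in ?E xs" and mx: "\<And>ys. cycle_in ?E ys \<Longrightarrow> length ys \<le> length xs"
    using ex_has_greatest_nat[of "cycle_in ?E" _ length "Suc (card ?V)"]
      two_connected_has_cycle[OF G tc] bd by blast
  have "set xs = ?V"
  proof (rule ccontr)
    assume "set xs \<noteq> ?V"
    then obtain v0 where v0: "v0 \<in> ?V - set xs" using sub[OF xs] by auto
    have len: "3 \<le> card (set xs)" using xs by (simp add: cycle_in_def distinct_card)
    then obtain u0 where u0: "u0 \<in> set xs" by fastforce
    \<comment> \<open>The ear starts with an edge leaving the cycle at \<open>a\<close> and returns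
      by a path that avoids \<open>a\<close>, which 2-connectedness provides.\<close>
    obtain a v where av: "(a, v) \<in> ?E" "a \<in> set xs" "v \<in> ?V" "v \<notin> set xs"
      using conn_on_leaves[OF con, of u0 "set xs" v0] u0 v0 sub[OF xs] by blast
    have aV: "a \<in> ?V" using av sub[OF xs] by auto
    have "\<not> set xs \<subseteq> {a}" using len card_mono[of "{a}" "set xs"] by auto
    then obtain c where c: "c \<in> set xs" "c \<noteq> a" by auto
    have "(v, c) \<in> (Restr ?E (?V - {a}))\<^sup>*"
      using con'[OF aV] av c sub[OF xs] by (auto intro!: conn_onD)
    from path_in_exists[OF this] obtain p where p: "p \<noteq> []" "hd p = v" "last p = c" "distinct p"
      "path_in ?E p" "set p \<subseteq> ?V - {a}" using av by auto
    have "\<exists>x\<in>set p. x \<in> set xs" using p(1,3) c by (metis last_in_set)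
    \<comment> \<open>Cutting at the first cycle vertex \<open>b\<close> leaves \<open>ds\<close>
      disjoint from the cycle.\<close>
    from split_list_first_prop[OF this]
    obtain ds b rest where ds: "p = ds @ b # rest" "b \<in> set xs" "\<forall>x\<in>set ds. x \<notin> set xs"
      by blast
    have dsne: "ds \<noteq> []" using ds p(2) av by auto
    have "a \<noteq> b" using ds p by auto
    from cycle_in_split[OF xs av(2) ds(2) this] obtain ys zs where
      yz: "cycle_in ?E (a # ys @ b # zs)" "set (a # ys @ b # zs) = set xs"
        "length (a # ys @ b # zs) = length xs" .
    have "has_K23_minor G \<or> (\<exists>xs. cycle_in ?E xs \<and> length xs > length (a # ys @ b # zs))"
    proof (rule ear_K23_minor_or_longer_cycle[OF G yz(1)])
      show "path_in ?E ds" "distinct ds" "(last ds, b) \<in> ?E"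
        using p ds dsne by (auto simp: path_in_append)
      show "(a, hd ds) \<in> ?E" using p ds dsne av by auto
      show "set ds \<inter> set (a # ys @ b # zs) = {}" using ds yz(2) by auto
    qed (rule dsne)
    then show False using K mx yz(3) by fastforce
  qed
  then show ?thesis using that xs by blast
qed

text \<open>
  The sides are \<open>{a, c}\<close>, the ends of the nonempty arc \<open>ps\<close>, and three arcs: \<open>ps\<close>, the one from \<open>c\<close>
  up to \<open>d\<close>, joined to \<open>a\<close> by the first chord, and the remainder, joined to \<open>c\<close> by the second.
\<close>

lemma crossing_chords_K23_minor:
  assumes G: "pair_graph G"
    and c: "cycle_in (parcs G) (a # ps @ c # qs @ b # rs @ d # ts)"
    and e: "(a, b) \<in> parcs G" "(c, d) \<in> parcs G" and ne: "ps \<noteq> []"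
  shows "has_K23_minor G"
proof -
  note sym = pair_graph_sym[OF G]
  have "(a, hd ps) \<in> parcs G" "(last ps, c) \<in> parcs G" "(c, hd (qs @ [b])) \<in> parcs G"
    "(last (d # ts), a) \<in> parcs G"
    using c ne by (auto simp: cycle_in_def path_in_append path_in_Cons hd_append)
  note f = this(1,2) symD[OF sym this(3)] symD[OF sym this(4)] symD[OF sym e(2)]
  have h: "hd (qs @ [b]) \<in> set (qs @ b # rs)" by (cases qs) auto
  have l: "last (d # ts) \<in> set (d # ts)" by (rule last_in_set) simp
  show ?thesis
  proof (rule theta_K23_minor[OF G, of ps "qs @ b # rs" "d # ts" a c])
    show "(\<exists>v\<in>set xs. (a, v) \<in> parcs G) \<and> (\<exists>v\<in>set xs. (v, c) \<in> parcs G)"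
      if xs: "xs \<in> {ps, qs @ b # rs, d # ts}" for xs
    proof -
      consider "xs = ps" | "xs = qs @ b # rs" | "xs = d # ts" using xs by blast
      then show ?thesis
      proof cases
        case 1
        then show ?thesis using f ne hd_in_set[OF ne] last_in_set[OF ne] by blast
      next
        case 2
        then show ?thesis using f(3) h e(1) by (metis in_set_conv_decomp)
      next
        case 3
        then show ?thesis using f(4,5) l by (metis list.set_intros(1))
      qed
    qed
    have "path_in (parcs G) ((a # ps @ [c]) @ (qs @ b # rs) @ (d # ts))" using c by (simp add: cycle_in_def)
    then show "path_in (parcs G) (qs @ b # rs)" "path_in (parcs G) (d # ts)"
      unfolding path_in_append by blast+
    show "path_in (parcs G) ps"
      using c by (simp add: cycle_in_def path_in_append path_in_Cons)
    have "distinct (a # ps @ c # qs @ b # rs @ d # ts)" using c by (simp only: cycle_in_def)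
    then show "distinct (a # c # ps @ (qs @ b # rs) @ d # ts)" by auto
  qed (use ne in simp_all)
qed

text \<open>Each of the four arcs between consecutive chord ends must be empty. The preceding lemma
  excludes a nonempty first arc only, so it is applied to four rotations, with the chords exchanged
  or reversed accordingly.\<close>

lemma crossing_chords_length:
  assumes G: "pair_graph G" and K: "\<not> has_K23_minor G"
    and c: "cycle_in (parcs G) xs"
    and ij: "i < k" "k < j" "j < l" "l < length xs"
    and e: "(xs ! i, xs ! j) \<in> parcs G" "(xs ! k, xs ! l) \<in> parcs G"
  shows "length xs = 4"
proof -
  note sym = pair_graph_sym[OF G]
  let ?x = "\<lambda>m. xs ! m"
  define ps where "ps = take (k - Suc i) (drop (Suc i) xs)"
  define qs where "qs = take (j - Suc k) (drop (Suc k) xs)"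
  define rs where "rs = take (l - Suc j) (drop (Suc j) xs)"
  \<comment> \<open>The last arc wraps around the end of the list.\<close>
  define ts where "ts = drop (Suc l) xs @ take i xs"
  have seg: "drop m xs = take (n - m) (drop m xs) @ xs ! n # drop (Suc n) xs"
    if mn: "m \<le> n" "n < length xs" for m n
  proof -
    have "drop m xs = take (n - m) (drop m xs) @ drop (n - m) (drop m xs)" by (rule append_take_drop_id[symmetric])
    also have "drop (n - m) (drop m xs) = drop n xs" using mn by simp
    also have "\<dots> = xs ! n # drop (Suc n) xs" using mn by (simp add: Cons_nth_drop_Suc)
    finally show ?thesis .
  qed
  have "xs = take i xs @ ?x i # ps @ ?x k # qs @ ?x j # rs @ ?x l # drop (Suc l) xs"
    using seg[of 0 i] seg[of "Suc i" k] seg[of "Suc k" j] seg[of "Suc j" l] ij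
    unfolding ps_def qs_def rs_def by simp
  then have eq: "xs = take i xs @ (?x i # ps @ ?x k # qs @ ?x j # rs @ ?x l # drop (Suc l) xs)" .
  have "cycle_in (parcs G) ((?x i # ps @ ?x k # qs @ ?x j # rs @ ?x l # drop (Suc l) xs) @ take i xs)"
    by (rule cycle_in_rotate) (use c eq in simp)
  then have c1: "cycle_in (parcs G) (?x i # ps @ ?x k # qs @ ?x j # rs @ ?x l # ts)"
    by (simp add: ts_def)
  have c2: "cycle_in (parcs G) (?x k # qs @ ?x j # rs @ ?x l # ts @ ?x i # ps)"
    using cycle_in_rotate[of _ "?x i # ps" "?x k # qs @ ?x j # rs @ ?x l # ts"] c1 by simp
  have c3: "cycle_in (parcs G) (?x j # rs @ ?x l # ts @ ?x i # ps @ ?x k # qs)"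
    using cycle_in_rotate[of _ "?x k # qs" "?x j # rs @ ?x l # ts @ ?x i # ps"] c2 by simp
  have c4: "cycle_in (parcs G) (?x l # ts @ ?x i # ps @ ?x k # qs @ ?x j # rs)"
    using cycle_in_rotate[of _ "?x j # rs" "?x l # ts @ ?x i # ps @ ?x k # qs"] c3 by simp
  have "ps = []" "qs = []" "rs = []" "ts = []"
    using crossing_chords_K23_minor[OF G c1] crossing_chords_K23_minor[OF G c2]
      crossing_chords_K23_minor[OF G c3] crossing_chords_K23_minor[OF G c4]
      K e e[THEN symD[OF sym]] by blast+
  then have "length (ps @ qs @ rs @ ts) = 0" by simp
  then show ?thesis using ij by (simp add: ps_def qs_def rs_def ts_def)
qed


section \<open>Convex drawings\<close>

text \<open>
  The points of the circle are parametrised rationally, which makes the affine functional vanishing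
  on the chord between two parameters factorise at every other point of the circle.
\<close>

definition circ_pt :: "real \<Rightarrow> complex" where
  "circ_pt t = Complex ((1 - t\<^sup>2) / (1 + t\<^sup>2)) (2 * t / (1 + t\<^sup>2))"

definition chord_fun :: "real \<Rightarrow> real \<Rightarrow> complex \<Rightarrow> real" where
  "chord_fun s t z = (1 - Re z) - (s + t) * Im z + s * t * (1 + Re z)"

lemma circ_pt_denom: "1 + t\<^sup>2 > (0::real)" "1 + t\<^sup>2 \<noteq> (0::real)"
  by (auto simp: add_pos_nonneg add_nonneg_eq_0_iff)

lemma chord_fun_circ_pt:
  "chord_fun s t (circ_pt r) = 2 / (1 + r\<^sup>2) * ((r - s) * (r - t))"
proof -
  have 1: "1 - Re (circ_pt r) = 2 * r\<^sup>2 / (1 + r\<^sup>2)" "1 + Re (circ_pt r) = 2 / (1 + r\<^sup>2)"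
    using circ_pt_denom[of r] by (simp_all add: circ_pt_def field_simps)
  have 2: "Im (circ_pt r) = 2 * r / (1 + r\<^sup>2)" by (simp add: circ_pt_def)
  show ?thesis unfolding chord_fun_def 1 2 by (simp add: field_simps power2_eq_square diff_divide_distrib add_divide_distrib)
qed

lemma norm_circ_pt [simp]: "norm (circ_pt t) = 1"
proof -
  have "(1 - t\<^sup>2)\<^sup>2 + (2 * t)\<^sup>2 = (1 + t\<^sup>2)\<^sup>2" by (simp add: power2_eq_square algebra_simps)
  then have "((1 - t\<^sup>2) / (1 + t\<^sup>2))\<^sup>2 + (2 * t / (1 + t\<^sup>2))\<^sup>2 = 1"
    using circ_pt_denom[of t] by (simp add: power_divide flip: add_divide_distrib)
  then show ?thesis by (simp add: circ_pt_def cmod_def)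
qed

text \<open>The sign is negative exactly when \<open>r\<close> lies strictly between
  \<open>s\<close> and \<open>t\<close>, so it tells the two sides of the chord apart.\<close>

lemma chord_fun_circ_pt_sgn:
  "sgn (chord_fun s t (circ_pt r)) = sgn ((r - s) * (r - t))"
  using circ_pt_denom(1)[of r] by (simp add: chord_fun_circ_pt sgn_mult)

lemma chord_fun_circ_pt_eq_0: "chord_fun s t (circ_pt r) = 0 \<longleftrightarrow> r = s \<or> r = t"
  using circ_pt_denom[of r] by (auto simp: chord_fun_circ_pt)

lemma inj_circ_pt: "inj circ_pt"
  using chord_fun_circ_pt_eq_0 by (metis injI)

lemma chord_fun_convex_comb:
  "chord_fun s t ((1 - u) *\<^sub>R x + u *\<^sub>R y) = (1 - u) * chord_fun s t x + u * chord_fun s t y"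
  by (simp add: chord_fun_def algebra_simps)

lemma chord_fun_segment_0:
  assumes "z \<in> closed_segment (circ_pt s) (circ_pt t)"
  shows "chord_fun s t z = 0"
proof -
  obtain u where "z = (1 - u) *\<^sub>R circ_pt s + u *\<^sub>R circ_pt t"
    using assms by (auto simp: in_segment)
  then show ?thesis by (simp add: chord_fun_convex_comb chord_fun_circ_pt)
qed

lemma circ_pt_in_chord_iff:
  "circ_pt r \<in> closed_segment (circ_pt s) (circ_pt t) \<longleftrightarrow> r = s \<or> r = t"
  using chord_fun_segment_0[of "circ_pt r" s t] by (auto simp: chord_fun_circ_pt_eq_0)

text \<open>The functional of the first chord is affine along the second and nonzero at
  \<open>r\<close>, so it has at most one zero there.\<close>

lemma finite_chords_Int:
  assumes "r \<notin> {s, t}"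
  shows "finite (closed_segment (circ_pt s) (circ_pt t) \<inter> closed_segment (circ_pt r) (circ_pt q))"
proof -
  let ?f = "chord_fun s t"
  \<comment> \<open>The solution of the linear equation for the zero. Its denominator is nonzero as
    soon as a common point exists; otherwise there is nothing to show.\<close>
  define u0 where "u0 = ?f (circ_pt r) / (?f (circ_pt r) - ?f (circ_pt q))"
  have "z = (1 - u0) *\<^sub>R circ_pt r + u0 *\<^sub>R circ_pt q"
    if z: "z \<in> closed_segment (circ_pt s) (circ_pt t)" "z \<in> closed_segment (circ_pt r) (circ_pt q)" for z
  proof -
    obtain u where u: "z = (1 - u) *\<^sub>R circ_pt r + u *\<^sub>R circ_pt q"
      using z(2) by (auto simp: in_segment)
    have "(1 - u) * ?f (circ_pt r) + u * ?f (circ_pt q) = 0"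
      using chord_fun_segment_0[OF z(1)] by (simp add: u chord_fun_convex_comb)
    then have *: "u * (?f (circ_pt r) - ?f (circ_pt q)) = ?f (circ_pt r)" by (simp add: algebra_simps)
    have "?f (circ_pt r) \<noteq> 0" using assms by (simp add: chord_fun_circ_pt_eq_0)
    then have "?f (circ_pt r) - ?f (circ_pt q) \<noteq> 0" using * by auto
    then have "u = u0" using * by (simp add: u0_def eq_divide_eq)
    then show ?thesis using u by simp
  qed
  then have "closed_segment (circ_pt s) (circ_pt t) \<inter> closed_segment (circ_pt r) (circ_pt q)
      \<subseteq> {(1 - u0) *\<^sub>R circ_pt r + u0 *\<^sub>R circ_pt q}" by blast
  then show ?thesis using finite_subset by blast
qed

text \<open>The functional of the first chord vanishes at an interior point of the second; as it
  does not vanish at both ends, affinity forces opposite signs there.\<close>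

lemma chords_meet_separates:
  assumes z: "z \<in> closed_segment (circ_pt s) (circ_pt t)" "z \<in> closed_segment (circ_pt r) (circ_pt q)"
    and nz: "z \<notin> {circ_pt r, circ_pt q}" and ne: "{s, t} \<noteq> {r, q}" "r \<noteq> q"
  shows "(r - s) * (r - t) * ((q - s) * (q - t)) < 0"
proof -
  let ?f = "chord_fun s t"
  obtain u where u: "z = (1 - u) *\<^sub>R circ_pt r + u *\<^sub>R circ_pt q" "0 \<le> u" "u \<le> 1"
    using z(2) by (auto simp: in_segment)
  have "u \<noteq> 0" "u \<noteq> 1" using nz u by auto
  then have u01: "0 < u" "u < 1" using u by auto
  have eq: "(1 - u) * ?f (circ_pt r) + u * ?f (circ_pt q) = 0"
    using chord_fun_segment_0[OF z(1)] by (simp add: u chord_fun_convex_comb)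
  have "\<not> (?f (circ_pt r) = 0 \<and> ?f (circ_pt q) = 0)"
    using ne by (auto simp: chord_fun_circ_pt_eq_0)
  then have n0: "?f (circ_pt r) \<noteq> 0" "?f (circ_pt q) \<noteq> 0" using eq u01 by auto
  have "sgn ((1 - u) * ?f (circ_pt r)) = sgn (- (u * ?f (circ_pt q)))" using eq
    by (intro arg_cong[of _ _ sgn]) linarith
  then have "sgn (?f (circ_pt r)) = - sgn (?f (circ_pt q))" using u01 by (simp add: sgn_mult sgn_minus)
  then have "sgn (?f (circ_pt r)) * sgn (?f (circ_pt q)) = - 1" using n0 by (auto simp: sgn_if split: if_splits)
  then have "sgn ((r - s) * (r - t) * ((q - s) * (q - t))) = - 1"
    by (simp only: chord_fun_circ_pt_sgn sgn_mult)
  then show ?thesis by (metis sgn_less neg_less_0_iff_less zero_less_one)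
qed

text \<open>The combinatorial counterpart of crossing chords. Two alternatives occur because the
  smallest position may belong to either edge.\<close>

definition interleaved :: "'a list \<Rightarrow> 'a set \<Rightarrow> 'a set \<Rightarrow> bool" where
  "interleaved xs e f \<longleftrightarrow> (\<exists>i k j l. i < k \<and> k < j \<and> j < l \<and> l < length xs \<and>
     (e = {xs ! i, xs ! j} \<and> f = {xs ! k, xs ! l} \<or> f = {xs ! i, xs ! j} \<and> e = {xs ! k, xs ! l}))"

text \<open>A negative product means that one of \<open>k\<close> and \<open>l\<close> lies strictly
  between \<open>i\<close> and \<open>j\<close> and the other strictly outside.\<close>

lemma separates_nat_interleaved:
  fixes i j k l :: nat
  assumes "(real k - real i) * (real k - real j) * ((real l - real i) * (real l - real j)) < 0"
    and "i < j" "k < l"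
  shows "i < k \<and> k < j \<and> j < l \<or> k < i \<and> i < l \<and> l < j"
  using assms by (auto simp: mult_less_0_iff zero_less_mult_iff)

text \<open>The vertex at position \<open>i\<close> of \<open>xs\<close> is placed at parameter
  \<open>i\<close>, so the order on the circle is the list order and
  \<open>chords_meet_separates\<close> turns crossings into interleaving.\<close>

lemma convex_drawing:
  assumes G: "pair_graph G" and xs: "distinct xs" "set xs = pverts G"
  shows "\<exists>pos \<gamma>. disk_drawing G pos \<gamma> \<and>
    (\<forall>e\<in>uedges G. \<forall>f\<in>uedges G. crosses G pos \<gamma> e f \<longrightarrow> interleaved xs e f)"
proof -
  define n where "n = length xs"
  define idx where "idx = the_inv_into {..<n} (\<lambda>i. xs ! i)"
  have inj: "inj_on (\<lambda>i. xs ! i) {..<n}" using xs(1) by (simp add: inj_on_nth n_def)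
  have idx [simp]: "idx (xs ! i) = i" if "i < n" for i
    using the_inv_into_f_f[OF inj] that by (simp add: idx_def)
  define pos where "pos v = circ_pt (real (idx v))" for v
  \<comment> \<open>An edge is an unordered set; the choice fixes an order of its two positions,
    which orients the chord.\<close>
  define ends where "ends e = (SOME (i, j). i < j \<and> j < n \<and> e = {xs ! i, xs ! j})" for e
  define \<gamma> where "\<gamma> e = (case ends e of (i, j) \<Rightarrow> linepath (circ_pt (real i)) (circ_pt (real j)))" for e
  have V: "pverts G = (\<lambda>i. xs ! i) ` {..<n}" 
    unfolding xs(2)[symmetric] set_conv_nth n_def by blast
  have ends: "\<exists>i j. i < j \<and> j < n \<and> e = {xs ! i, xs ! j} \<and> \<gamma> e = linepath (circ_pt (real i)) (circ_pt (real j))"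
    if e: "e \<in> uedges G" for e
  proof -
    obtain u v where uv: "(u, v) \<in> parcs G" "e = {u, v}" using e by (auto simp: uedges_def)
    then have "u \<in> pverts G" "v \<in> pverts G" "u \<noteq> v"
      using pair_graph_subset[OF G] pair_graph_irrefl[OF G] by auto
    then obtain i j where ij: "i < n" "j < n" "u = xs ! i" "v = xs ! j" "i \<noteq> j" unfolding V by auto
    have "e = {xs ! min i j, xs ! max i j}" "min i j < max i j" "max i j < n"
      using uv ij by (auto simp: min_def max_def)
    then have "\<exists>p. case p of (i, j) \<Rightarrow> i < j \<and> j < n \<and> e = {xs ! i, xs ! j}"
      by (intro exI[of _ "(min i j, max i j)"]) simp
    then have "case ends e of (i, j) \<Rightarrow> i < j \<and> j < n \<and> e = {xs ! i, xs ! j}"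
      unfolding ends_def by (rule someI_ex)
    then show ?thesis by (auto simp: \<gamma>_def split: prod.splits)
  qed
  have pos [simp]: "pos (xs ! i) = circ_pt (real i)" if "i < n" for i using that by (simp add: pos_def)
  have pos_image: "pos ` pverts G = (\<lambda>i. circ_pt (real i)) ` {..<n}"
    unfolding V image_image by (intro image_cong) auto
  have "inj_on pos (pverts G)"
    unfolding V by (rule inj_onI) (auto simp: inj_eq[OF inj_circ_pt])
  moreover have "pos ` pverts G \<subseteq> sphere 0 1" by (auto simp: pos_def)
  moreover have "arc (\<gamma> e) \<and> {pathstart (\<gamma> e), pathfinish (\<gamma> e)} = pos ` e \<and>
        path_image (\<gamma> e) \<subseteq> cball 0 1 \<and> path_image (\<gamma> e) \<inter> pos ` pverts G = pos ` e"
    if e: "e \<in> uedges G" for e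
  proof -
    obtain i j where ij: "i < j" "j < n" "e = {xs ! i, xs ! j}"
      "\<gamma> e = linepath (circ_pt (real i)) (circ_pt (real j))" using ends[OF e] by blast
    have "circ_pt (real i) \<noteq> circ_pt (real j)" using ij by (simp add: inj_eq[OF inj_circ_pt])
    then have "arc (\<gamma> e)" using ij by simp
    moreover have "path_image (\<gamma> e) \<subseteq> cball 0 1"
      unfolding ij(4) path_image_linepath by (rule closed_segment_subset) auto
    moreover have "path_image (\<gamma> e) \<inter> pos ` pverts G = pos ` e"
      unfolding pos_image ij(4) path_image_linepath using ij(1-3) by (auto simp: circ_pt_in_chord_iff)
    ultimately show ?thesis using ij by simp
  qed
  moreover have "finite (path_image (\<gamma> e) \<inter> path_image (\<gamma> f))"
    if ef: "e \<in> uedges G" "f \<in> uedges G" "e \<noteq> f" for e f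
  proof -
    obtain i j where ij: "i < j" "j < n" "e = {xs ! i, xs ! j}"
      "\<gamma> e = linepath (circ_pt (real i)) (circ_pt (real j))" using ends[OF ef(1)] by blast
    obtain k l where kl: "k < l" "l < n" "f = {xs ! k, xs ! l}"
      "\<gamma> f = linepath (circ_pt (real k)) (circ_pt (real l))" using ends[OF ef(2)] by blast
    \<comment> \<open>Distinct edges leave one end of \<open>f\<close> outside \<open>e\<close>, and
      this end can take the role of \<open>r\<close> in \<open>finite_chords_Int\<close>.\<close>
    have "k \<notin> {i, j} \<or> l \<notin> {i, j}" using ij kl ef(3) by auto
    then show ?thesis
      using finite_chords_Int[of "real k" "real i" "real j" "real l"]
        finite_chords_Int[of "real l" "real i" "real j" "real k"]
      by (auto simp: ij(4) kl(4) closed_segment_commute)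
  qed
  ultimately have "disk_drawing G pos \<gamma>" by (simp add: disk_drawing_def)
  moreover have "interleaved xs e f"
    if ef: "e \<in> uedges G" "f \<in> uedges G" "crosses G pos \<gamma> e f" for e f
  proof -
    obtain i j where ij: "i < j" "j < n" "e = {xs ! i, xs ! j}"
      "\<gamma> e = linepath (circ_pt (real i)) (circ_pt (real j))" using ends[OF ef(1)] by blast
    obtain k l where kl: "k < l" "l < n" "f = {xs ! k, xs ! l}"
      "\<gamma> f = linepath (circ_pt (real k)) (circ_pt (real l))" using ends[OF ef(2)] by blast
    obtain z where z: "z \<in> closed_segment (circ_pt (real i)) (circ_pt (real j))"
        "z \<in> closed_segment (circ_pt (real k)) (circ_pt (real l))" "z \<notin> pos ` pverts G"
      using ef(3) by (auto simp: crosses_def ij(4) kl(4))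
    have "circ_pt (real k) \<in> pos ` pverts G" "circ_pt (real l) \<in> pos ` pverts G"
      using kl unfolding pos_image by auto
    then have "z \<notin> {circ_pt (real k), circ_pt (real l)}" using z(3) by auto
    moreover have "{real i, real j} \<noteq> {real k, real l}"
      using ef(3) ij kl by (auto simp: crosses_def doubleton_eq_iff)
    ultimately have "(real k - real i) * (real k - real j) * ((real l - real i) * (real l - real j)) < 0"
      using chords_meet_separates[OF z(1,2)] kl(1) by simp
    from separates_nat_interleaved[OF this ij(1) kl(1)] show ?thesis
      using ij kl unfolding interleaved_def n_def by blast
  qed
  ultimately show ?thesis by blast
qed


section \<open>Blocks\<close>

lemma hamiltonian_cycleI:
  assumes G: "pair_graph G" and c: "cycle_in (parcs G) xs" "set xs = pverts G"
  shows "hamiltonian G"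
proof -
  interpret pair_graph G by fact
  obtain x ys where xs: "xs = x # ys" using c(1) by (cases xs) (auto simp: cycle_in_def)
  \<comment> \<open>\<open>ys @ [x]\<close> is the cycle shifted by one place, so the pairs are its
    arcs, including the closing one, and their tails give back \<open>xs\<close>.\<close>
  let ?p = "zip xs (ys @ [x])"
  have walk: "pcas a (zip (a # bs) (bs @ [z])) z \<and> pawalk_verts a (zip (a # bs) (bs @ [z])) = a # bs @ [z]"
    for a z and bs :: "'a list"
    by (induction bs arbitrary: a) auto
  have sub: "set (zip (a # bs) (bs @ [z])) \<subseteq> parcs G" if "path_in (parcs G) (a # bs @ [z])"
    for a z and bs :: "'a list"
    using that by (induction bs arbitrary: a) auto
  have "path_in (parcs G) (x # ys @ [x])"
    using c(1) path_in_append[of "parcs G" xs "[x]"] by (auto simp: cycle_in_def xs)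
  then have "awalk x ?p x" using sub walk c(2) by (auto simp: awalk_def xs)
  moreover have "distinct (tl (pawalk_verts x ?p))" using walk c(1) by (simp add: xs cycle_in_def)
  ultimately have "cycle ?p" unfolding cycle_def by (auto simp: xs)
  moreover have "map fst ?p = xs" by (simp add: xs)
  then have "fst ` set ?p = pverts G" using c(2) by (metis list.set_map)
  ultimately show ?thesis
    using c(1) unfolding hamiltonian_def by (intro exI[of _ ?p]) (auto simp: cycle_in_def xs)
qed

definition good_drawing :: "'a pair_pre_digraph \<Rightarrow> bool" where
  "good_drawing B \<longleftrightarrow> (\<exists>pos \<gamma>. disk_drawing B pos \<gamma> \<and>
        (\<forall>e\<in>uedges B. \<forall>f\<in>uedges B. \<forall>g\<in>uedges B.
           crosses B pos \<gamma> e f \<and> crosses B pos \<gamma> e g \<longrightarrow> f = g))"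

lemma good_drawingI:
  assumes G: "pair_graph G" and xs: "distinct xs" "set xs = pverts G"
    and unique: "\<And>e f g. e \<in> uedges G \<Longrightarrow> f \<in> uedges G \<Longrightarrow> g \<in> uedges G \<Longrightarrow>
      interleaved xs e f \<Longrightarrow> interleaved xs e g \<Longrightarrow> f = g"
  shows "good_drawing G"
proof -
  obtain pos \<gamma> where "disk_drawing G pos \<gamma>"
    "\<forall>e\<in>uedges G. \<forall>f\<in>uedges G. crosses G pos \<gamma> e f \<longrightarrow> interleaved xs e f"
    using convex_drawing[OF G xs] by blast
  then show ?thesis unfolding good_drawing_def using unique by metis
qed

lemma interleaved_length: "interleaved xs e f \<Longrightarrow> 4 \<le> length xs"
  by (auto simp: interleaved_def)

text \<open>Interleaving takes four positions, so no chords cross. This handles the blocks with at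
  most two vertices.\<close>

lemma good_drawing_small:
  assumes "pair_graph G" "card (pverts G) \<le> 3"
  shows "good_drawing G"
proof -
  obtain xs where xs: "distinct xs" "set xs = pverts G"
    using finite_distinct_list[OF pair_graph_finite[OF assms(1)]] by blast
  then have "length xs \<le> 3" using assms(2) by (metis distinct_card)
  then show ?thesis
    using interleaved_length[of xs] by (intro good_drawingI[OF assms(1) xs]) fastforce
qed

lemma doubleton_in_uedges:
  assumes "pair_graph G" "{u, v} \<in> uedges G"
  shows "(u, v) \<in> parcs G"
  using assms(2) symD[OF pair_graph_sym[OF assms(1)]] by (auto simp: uedges_def doubleton_eq_iff)

text \<open>With four entries the positions are forced to be 0, 1, 2, 3, so \<open>e\<close> and
  \<open>f\<close> are complementary, which determines \<open>f\<close> from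
  \<open>e\<close>.\<close>

lemma interleaved_length_4:
  assumes "interleaved xs e f" "length xs = 4" "distinct xs"
  shows "f = set xs - e"
proof -
  obtain i k j l where *: "i < k" "k < j" "j < l" "l < length xs"
    "e = {xs ! i, xs ! j} \<and> f = {xs ! k, xs ! l} \<or> f = {xs ! i, xs ! j} \<and> e = {xs ! k, xs ! l}"
    using assms(1) unfolding interleaved_def by blast
  have ijkl: "i = 0" "k = 1" "j = 2" "l = 3" using *(1-4) assms(2) by linarith+
  have four: "{..<4::nat} = {0, 1, 2, 3}" by auto
  have "set xs = (!) xs ` {..<4}" unfolding set_conv_nth assms(2) by blast
  then have "set xs = {xs ! 0, xs ! 1, xs ! 2, xs ! 3}" unfolding four by simp
  moreover have "distinct [xs ! 0, xs ! 1, xs ! 2, xs ! 3]"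
    using assms(2,3) by (simp add: nth_eq_iff_index_eq)
  moreover have "{a, c} = {a, b, c, d} - {b, d}" "{b, d} = {a, b, c, d} - {a, c}"
    if "distinct [a, b, c, d]" for a b c d :: 'a
    using that by auto
  ultimately show ?thesis using *(5) unfolding ijkl by metis
qed

lemma two_connected_no_K23_minor:
  assumes G: "pair_graph G" and tc: "two_connected G" and K: "\<not> has_K23_minor G"
  shows "hamiltonian G" "good_drawing G"
proof -
  obtain xs where xs: "cycle_in (parcs G) xs" "set xs = pverts G"
    by (rule two_connected_hamiltonian_cycle[OF assms])
  show "hamiltonian G" by (rule hamiltonian_cycleI[OF G xs])
  have d: "distinct xs" using xs by (simp add: cycle_in_def)
  show "good_drawing G"
  proof (rule good_drawingI[OF G d xs(2)])
    fix e f g assume e: "e \<in> uedges G" and f: "f \<in> uedges G"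
      and ef: "interleaved xs e f" and eg: "interleaved xs e g"
    obtain i k j l where *: "i < k" "k < j" "j < l" "l < length xs"
      "e = {xs ! i, xs ! j} \<and> f = {xs ! k, xs ! l} \<or> f = {xs ! i, xs ! j} \<and> e = {xs ! k, xs ! l}"
      using ef unfolding interleaved_def by blast
    then have "(xs ! i, xs ! j) \<in> parcs G" "(xs ! k, xs ! l) \<in> parcs G"
      using e f doubleton_in_uedges[OF G] by auto
    then have "length xs = 4" by (rule crossing_chords_length[OF G K xs(1) *(1-4)])
    then show "f = g" using interleaved_length_4[OF ef _ d] interleaved_length_4[OF eg _ d] by simp
  qed
qed

lemma K1_vertex: "K\<^bsub>1\<^esub> (with_proj \<lparr>pverts = {v}, parcs = {}\<rparr>)"
  by (auto simp: complete_digraph_pair_def)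

lemma K2_edge: "u \<noteq> v \<Longrightarrow> K\<^bsub>2\<^esub> (with_proj \<lparr>pverts = {u, v}, parcs = {(u, v), (v, u)}\<rparr>)"
  by (auto simp: complete_digraph_pair_def)

text \<open>Isolated vertices and bridges are complete graphs on at most two vertices, hence satisfy
  both conditions; only maximal 2-connected subgraphs are left to check.\<close>

lemma PH_iff:
  assumes G: "pair_graph G"
  shows "G \<in> PH \<longleftrightarrow> (\<forall>B. two_connected_subgraph B G \<and>
      (\<forall>C. two_connected_subgraph C G \<and> subgraph (with_proj B) (with_proj C) \<longrightarrow> C = B) \<longrightarrow>
      hamiltonian B \<and> good_drawing B)" (is "_ \<longleftrightarrow> (\<forall>B. ?max B \<longrightarrow> _)")
proof
  assume "G \<in> PH"
  show "\<forall>B. ?max B \<longrightarrow> hamiltonian B \<and> good_drawing B"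
  proof (intro allI impI)
    fix B assume B: "?max B"
    then have "is_block B G" unfolding is_block_def by blast
    with \<open>G \<in> PH\<close> have "hamiltonian B \<or> K\<^bsub>1\<^esub> (with_proj B) \<or> K\<^bsub>2\<^esub> (with_proj B)" "good_drawing B"
      by (auto simp: PH_def quasi_hamiltonian_def pseudo_outerplanar_def good_drawing_def)
    moreover have "3 \<le> card (pverts B)"
      using B by (auto simp: two_connected_subgraph_def two_connected_def)
    ultimately show "hamiltonian B \<and> good_drawing B" by (auto simp: complete_digraph_pair_def)
  qed
next
  assume max: "\<forall>B. ?max B \<longrightarrow> hamiltonian B \<and> good_drawing B"
  have "(hamiltonian B \<or> K\<^bsub>1\<^esub> (with_proj B) \<or> K\<^bsub>2\<^esub> (with_proj B)) \<and> good_drawing B"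
    if "is_block B G" for B
  proof -
    consider "?max B" | "K\<^bsub>1\<^esub> (with_proj B)" | "K\<^bsub>2\<^esub> (with_proj B)"
      using \<open>is_block B G\<close> pair_graph_irrefl[OF G] K1_vertex K2_edge
      unfolding is_block_def bridge_def by metis
    then show ?thesis
    proof cases
      case 1
      then show ?thesis using max by blast
    next
      case 2
      then show ?thesis
        using good_drawing_small[OF pair_graphI_complete[OF 2]] by (simp add: complete_digraph_pair_def)
    next
      case 3
      then show ?thesis
        using good_drawing_small[OF pair_graphI_complete[OF 3]] by (simp add: complete_digraph_pair_def)
    qed
  qed
  then show "G \<in> PH"
    using G by (auto simp: PH_def quasi_hamiltonian_def pseudo_outerplanar_def good_drawing_def)
qed

lemma M23_subset_PH: "M23 \<subseteq> PH"
proof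
  fix G :: "'a pair_pre_digraph" assume "G \<in> M23"
  then have G: "pair_graph G" and K: "\<not> has_K23_minor G" by (auto simp: M23_def)
  show "G \<in> PH"
    unfolding PH_iff[OF G]
  proof (intro allI impI, elim conjE)
    fix B assume "two_connected_subgraph B G"
    then have B: "pair_graph B" "two_connected B" "pverts B \<subseteq> pverts G" "parcs B \<subseteq> parcs G"
      by (auto simp: two_connected_subgraph_def subgraph_def)
    then have "\<not> has_K23_minor B" using has_K23_minor_mono G K by blast
    then show "hamiltonian B \<and> good_drawing B" using two_connected_no_K23_minor B by blast
  qed
qed


section \<open>A graph in \<open>\<P>\<^sub>H\<close> with a \<open>K\<^bsub>2,3\<^esub>\<close> minor\<close>

text \<open>
  The complete graph on \<open>{0, 1, 2, 3}\<close> with an additional vertex \<open>4\<close> adjacent to \<open>0\<close> and \<open>3\<close>.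
  On the circle only the chords \<open>{0, 2}\<close> and \<open>{1, 3}\<close> cross, and \<open>K\<^bsub>2,3\<^esub>\<close> with sides
  \<open>{0, 3}\<close> and \<open>{1, 2, 4}\<close> is a subgraph.
\<close>

definition K4_ear :: "nat pair_pre_digraph" where
  "K4_ear = \<lparr>pverts = {0, 1, 2, 3, 4},
     parcs = {(u, v). u \<noteq> v \<and> u \<le> 4 \<and> v \<le> 4} - {(1, 4), (4, 1), (2, 4), (4, 2)}\<rparr>"

lemma pverts_K4_ear: "pverts K4_ear = {0, 1, 2, 3, 4}"
  by (simp add: K4_ear_def)

lemma parcs_K4_ear: "(u, v) \<in> parcs K4_ear \<longleftrightarrow>
    u \<noteq> v \<and> u \<le> 4 \<and> v \<le> 4 \<and> (u, v) \<notin> {(1, 4), (4, 1), (2, 4), (4, 2)}"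
  by (simp add: K4_ear_def)

lemma pair_graph_K4_ear: "pair_graph K4_ear"
proof -
  have "parcs K4_ear \<subseteq> {..4} \<times> {..4}" by (auto simp: K4_ear_def)
  then have "finite (parcs K4_ear)" by (rule finite_subset) simp
  moreover have "sym (parcs K4_ear)" by (rule symI) (auto simp: parcs_K4_ear)
  ultimately show ?thesis
    by unfold_locales (auto simp: parcs_K4_ear pverts_K4_ear symmetric_def)
qed

lemma has_K23_minor_K4_ear: "has_K23_minor K4_ear"
proof (rule theta_K23_minor[OF pair_graph_K4_ear, of "[1]" "[2]" "[4]" 0 3])
qed (auto simp: parcs_K4_ear)

text \<open>Vertex 0 is adjacent to all others and serves as a centre; once it is deleted, vertex 3
  takes over.\<close>

lemma two_connected_K4_ear: "two_connected K4_ear"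
proof -
  note sym = pair_graph_sym[OF pair_graph_K4_ear]
  have "conn_on (parcs K4_ear) (pverts K4_ear)"
    by (rule conn_on_centerI[OF sym, of 0]) (auto simp: pverts_K4_ear parcs_K4_ear)
  moreover have "conn_on (parcs K4_ear) (pverts K4_ear - {v})" for v
  proof (cases "v = 0")
    case True
    then show ?thesis
      by (intro conn_on_centerI[OF sym, of 3]) (auto simp: pverts_K4_ear parcs_K4_ear)
  next
    case False
    then show ?thesis
      by (intro conn_on_centerI[OF sym, of 0]) (auto simp: pverts_K4_ear parcs_K4_ear)
  qed
  ultimately show ?thesis by (simp add: two_connected_iff[OF pair_graph_K4_ear] pverts_K4_ear)
qed

lemma interleaved_K4_ear:
  assumes ef: "e \<in> uedges K4_ear" "f \<in> uedges K4_ear" "interleaved [0, 1, 2, 3, 4] e f"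
  shows "e = {0, 2} \<and> f = {1, 3} \<or> e = {1, 3} \<and> f = {0, 2}"
proof -
  let ?xs = "[0, 1, 2, 3, 4] :: nat list"
  have nth: "?xs ! m = m" if "m < 5" for m
    using that by (auto simp: numeral_eq_Suc less_Suc_eq)
  obtain i k j l where ijkl: "i < k" "k < j" "j < l" "l < length ?xs"
    "e = {?xs ! i, ?xs ! j} \<and> f = {?xs ! k, ?xs ! l} \<or> f = {?xs ! i, ?xs ! j} \<and> e = {?xs ! k, ?xs ! l}"
    using ef(3) unfolding interleaved_def by blast
  then have l: "l < 5" by simp
  have *: "i < k" "k < j" "j < l" "l < 5" "e = {i, j} \<and> f = {k, l} \<or> f = {i, j} \<and> e = {k, l}"
    using ijkl(1-3,5) l nth[of i] nth[of j] nth[of k] nth[of l] by (simp_all del: nth_Cons_numeral)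
  then have "(k, l) \<in> parcs K4_ear"
    using ef(1,2) doubleton_in_uedges[OF pair_graph_K4_ear] by auto
  \<comment> \<open>If \<open>l\<close> were 4, then \<open>k\<close> would be 1 or 2, but 4 is
    adjacent to neither; hence the four positions are 0, 1, 2, 3.\<close>
  then have "l \<noteq> 4" using *(1-4) by (auto simp: parcs_K4_ear)
  then have "i = 0" "k = 1" "j = 2" "l = 3" using *(1-4) by linarith+
  then show ?thesis using *(5) by auto
qed

lemma K4_ear_in_PH: "K4_ear \<in> PH"
  unfolding PH_iff[OF pair_graph_K4_ear]
proof (intro allI impI, elim conjE)
  fix B assume B: "two_connected_subgraph B K4_ear"
    and max: "\<forall>C. two_connected_subgraph C K4_ear \<and> subgraph (with_proj B) (with_proj C) \<longrightarrow> C = B"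
  interpret pair_graph K4_ear by (rule pair_graph_K4_ear)
  have "two_connected_subgraph K4_ear K4_ear"
    using pair_graph_K4_ear two_connected_K4_ear subgraph_refl by (simp add: two_connected_subgraph_def)
  \<comment> \<open>The graph is itself 2-connected, so a maximal 2-connected subgraph is the whole
    graph.\<close>
  then have eq: "B = K4_ear" using B max by (auto simp: two_connected_subgraph_def)
  have "cycle_in (parcs K4_ear) [0, 1, 2, 3, 4]" by (auto simp: cycle_in_def parcs_K4_ear)
  then have "hamiltonian K4_ear"
    by (rule hamiltonian_cycleI[OF pair_graph_K4_ear]) (auto simp: pverts_K4_ear)
  moreover have "good_drawing K4_ear"
  proof (rule good_drawingI[OF pair_graph_K4_ear, of "[0, 1, 2, 3, 4]"])
    fix e f g
    assume "e \<in> uedges K4_ear" "f \<in> uedges K4_ear" "g \<in> uedges K4_ear"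
      "interleaved [0, 1, 2, 3, 4] e f" "interleaved [0, 1, 2, 3, 4] e g"
    then have "e = {0, 2} \<and> f = {1, 3} \<or> e = {1, 3} \<and> f = {0, 2}"
      "e = {0, 2} \<and> g = {1, 3} \<or> e = {1, 3} \<and> g = {0, 2}"
      by (simp_all only: interleaved_K4_ear)
    moreover have "{0, 2} \<noteq> {1, 3::nat}" by auto
    ultimately show "f = g" by metis
  qed (auto simp: pverts_K4_ear)
  ultimately show "hamiltonian B \<and> good_drawing B" using eq by simp
qed

text \<open>Strictness is stated over \<open>nat\<close> because it needs a type with enough
  vertices; over a one-element type, for example, the two classes coincide.\<close>

theorem theorem2p9:
  shows "(M23 :: 'a pair_pre_digraph set) \<subseteq> PH \<and>
    (\<exists>G :: nat pair_pre_digraph. G \<in> PH \<and> has_K23_minor G) \<and>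
    (M23 :: nat pair_pre_digraph set) \<subset> PH"
proof -
  have "K4_ear \<notin> M23" using has_K23_minor_K4_ear by (simp add: M23_def)
  then have "(M23 :: nat pair_pre_digraph set) \<subset> PH" using M23_subset_PH K4_ear_in_PH by blast
  then show ?thesis using M23_subset_PH K4_ear_in_PH has_K23_minor_K4_ear by blast
qed

end
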